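(* Let $\epsilon>0$. For all but finitely many triples $(a,b,c)$ of coprime integers larger than $1$ satisfying $a+b=c$, there is $\psi\in\mathscr{T}(a,b)$ with $\|\psi\|<c^{\frac12+\epsilon}$ such that not all of the integers $\mathrm{d}^\psi(a)$, $\mathrm{d}^\psi(b)$, $\mathrm{d}^\psi(c)$ are zero.
   Context: For a prime $p$, $v_p$ is the $p$-adic valuation. For a non-zero integer $n$, $\mathrm{supp}(n)$ is the set of primes dividing $n$. Let $\Omega$ be the free $\mathbb{Z}$-module on symbols $\xi_p$, one for each prime $p$. Define $\mathrm{d}:\mathbb{Z}\to\Omega$ by $\mathrm{d}0=0$ and $\mathrm{d}n=\sum_{p\mid n}\frac{n\,v_p(n)}{p}\,\xi_p$ for $n\ne 0$ (the coefficients are integers). For a $\mathbb{Z}$-linear map $\psi:\Omega\to\mathbb{Z}$ put $\|\psi\|=\sup_p|\psi(\xi_p)|$. Let $\mathscr{T}$ be the $\mathbb{Z}$-module of all $\mathbb{Z}$-linear $\psi:\Omega\to\mathbb{Z}$ with $\|\psi\|<\infty$. For $\psi\in\mathscr{T}$ let $\mathrm{d}^\psi=\psi\circ\mathrm{d}:\mathbb{Z}\to\mathbb{Z}$ and $\mathrm{supp}(\psi)=\{p:\psi(\xi_p)\neq0\}$. For positive integers $a,b$, $$\mathscr{T}(a,b)=\{\psi\in\mathscr{T}:\ \mathrm{supp}(\psi)\subseteq\mathrm{supp}(ab(a+b))\ \text{and}\ \mathrm{d}^\psi(a+b)=\mathrm{d}^\psi a+\mathrm{d}^\psi b\}.$$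 *)

theory Defs
  imports
    "HOL-Algebra.Free_Abelian_Groups"
    "HOL-Computational_Algebra.Primes"
    "HOL-Library.Extended_Real"
begin

text \<open>The symbol \<open>\<xi>\<^sub>p\<close> is represented by \<^term>\<open>frag_of p\<close>.\<close>

definition Omega :: "(nat \<Rightarrow>\<^sub>0 int) monoid"
  where "Omega = free_Abelian_group {p. prime p}"

definition int_supp :: "int \<Rightarrow> nat set"
  where "int_supp n = {p. prime p \<and> int p dvd n}"

text \<open>The division in the coefficients is exact, by the lemma that follows.\<close>

definition arith_d :: "int \<Rightarrow> (nat \<Rightarrow>\<^sub>0 int)"
  where "arith_d n =
    (if n = 0 then 0
     else \<Sum>p\<in>int_supp n. frag_cmul (n * int (multiplicity (int p) n) div int p) (frag_of p))"

lemma arith_d_coeff_dvd: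
  assumes "p \<in> int_supp n"
  shows "int p dvd n * int (multiplicity (int p) n)"
  using assms by (simp add: int_supp_def)

lemma arith_d_in_Omega: "arith_d n \<in> carrier Omega"
proof (cases "n = 0")
  case False
  have "Poly_Mapping.keys (arith_d n) \<subseteq> (\<Union>p\<in>int_supp n.
      Poly_Mapping.keys (frag_cmul (n * int (multiplicity (int p) n) div int p) (frag_of p)))"
    using False by (simp add: arith_d_def keys_sum)
  also have "\<dots> \<subseteq> int_supp n"
    using keys_cmul by fastforce
  finally show ?thesis
    by (auto simp: Omega_def free_Abelian_group_def int_supp_def)
qed (simp add: arith_d_def Omega_def free_Abelian_group_def)

definition tnorm :: "((nat \<Rightarrow>\<^sub>0 int) \<Rightarrow> int) \<Rightarrow> ereal"
  where "tnorm \<psi> = (SUP p\<in>{p::nat. prime p}. ereal (of_int \<bar>\<psi> (frag_of p)\<bar>))"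

text \<open>\<open>\<int>\<close>-linear maps are the same as homomorphisms of abelian groups. They are required to be
  extensional, so that elements of \<open>tangent\<close> agreeing on \<^term>\<open>carrier Omega\<close> are equal.\<close>

definition tangent :: "((nat \<Rightarrow>\<^sub>0 int) \<Rightarrow> int) set"
  where "tangent =
    {\<psi> \<in> hom Omega integer_group \<inter> extensional (carrier Omega). tnorm \<psi> < \<infinity>}"

definition dpsi :: "((nat \<Rightarrow>\<^sub>0 int) \<Rightarrow> int) \<Rightarrow> int \<Rightarrow> int"
  where "dpsi \<psi> = \<psi> \<circ> arith_d"

definition tsupp :: "((nat \<Rightarrow>\<^sub>0 int) \<Rightarrow> int) \<Rightarrow> nat set"
  where "tsupp \<psi> = {p. prime p \<and> \<psi> (frag_of p) \<noteq> 0}"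

definition tangent_at :: "int \<Rightarrow> int \<Rightarrow> ((nat \<Rightarrow>\<^sub>0 int) \<Rightarrow> int) set"
  where "tangent_at a b =
    {\<psi> \<in> tangent. tsupp \<psi> \<subseteq> int_supp (a * b * (a + b)) \<and>
                   dpsi \<psi> (a + b) = dpsi \<psi> a + dpsi \<psi> b}"

end

theory Submission
  imports Defs "HOL-Real_Asymp.Real_Asymp"
begin

text \<open>
  Choose primes \<open>p | a\<close>, \<open>q | b\<close>, \<open>r | c\<close>; they are distinct by coprimality. For \<open>\<psi>\<close> supported on
  \<open>{p, q, r}\<close>, each of the three derivatives is a positive integer coefficient times a single
  unknown, so additivity at \<open>(a, b)\<close> is one linear equation \<open>A x + B y = C z\<close>, and every nonzero
  solution has a nonzero derivative. Siegel's lemma, that is, the pigeonhole principle on a cube,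
  gives a nonzero solution of size at most \<open>sqrt (A + B + C)\<close>, and \<open>A + B + C \<le> c log\<^sub>2 c\<close>.
\<close>

text \<open>\<open>frag_extend\<close> takes values in free abelian groups, so the integers are
  modelled as the free group on the single generator \<open>()\<close>, and the lookup at
  \<open>()\<close> reads the integer off. The restriction supplies the extensionality that
  \<open>tangent\<close> demands.\<close>

definition linear_ext :: "(nat \<Rightarrow> int) \<Rightarrow> (nat \<Rightarrow>\<^sub>0 int) \<Rightarrow> int"
  where "linear_ext w = restrict
    (\<lambda>f. Poly_Mapping.lookup (frag_extend (\<lambda>p. frag_cmul (w p) (frag_of ())) f) ()) (carrier Omega)"

definition arith_coeff :: "int \<Rightarrow> nat \<Rightarrow> int"
  where "arith_coeff n p = n * int (multiplicity (int p) n) div int p"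

lemma linear_ext_hom: "linear_ext w \<in> hom Omega integer_group"
proof (rule homI)
  fix x y assume "x \<in> carrier Omega" "y \<in> carrier Omega"
  moreover have "x + y \<in> carrier Omega"
    using calculation Poly_Mapping.keys_add[of x y] by (auto simp: Omega_def free_Abelian_group_def)
  ultimately show "linear_ext w (x \<otimes>\<^bsub>Omega\<^esub> y) = linear_ext w x \<otimes>\<^bsub>integer_group\<^esub> linear_ext w y"
    by (simp add: linear_ext_def frag_extend_add lookup_add Omega_def free_Abelian_group_def)
qed simp

lemma linear_ext_frag_of:
  assumes "prime p"
  shows "linear_ext w (frag_of p) = w p"
  using assms by (simp add: linear_ext_def Omega_def)

lemma tnorm_linear_ext_le:
  assumes "\<And>p. \<bar>w p\<bar> \<le> H"
  shows "tnorm (linear_ext w) \<le> ereal (of_int H)"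
  unfolding tnorm_def
  by (rule SUP_least) (use assms in \<open>simp add: linear_ext_frag_of flip: of_int_abs\<close>)

lemma linear_ext_in_tangent:
  assumes "\<And>p. \<bar>w p\<bar> \<le> H"
  shows "linear_ext w \<in> tangent"
proof -
  have "tnorm (linear_ext w) < \<infinity>"
    using tnorm_linear_ext_le[OF assms] by (rule le_less_trans) simp
  then show ?thesis
    using linear_ext_hom by (simp add: tangent_def linear_ext_def)
qed

lemma finite_int_supp:
  assumes "n \<noteq> 0"
  shows "finite (int_supp n)"
proof (rule finite_subset)
  show "int_supp n \<subseteq> {d. d dvd nat \<bar>n\<bar>}"
    by (auto simp: int_supp_def)
  show "finite {d. d dvd nat \<bar>n\<bar>}"
    using assms by (intro finite_divisors_nat) simp
qed

lemma dpsi_linear_ext: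
  assumes "n \<noteq> 0"
  shows "dpsi (linear_ext w) n = (\<Sum>p\<in>int_supp n. arith_coeff n p * w p)"
proof -
  have "dpsi (linear_ext w) n
      = Poly_Mapping.lookup (frag_extend (\<lambda>p. frag_cmul (w p) (frag_of ())) (arith_d n)) ()"
    using arith_d_in_Omega by (simp add: dpsi_def linear_ext_def)
  then show ?thesis
    using assms finite_int_supp[OF assms]
    by (simp add: arith_d_def arith_coeff_def frag_extend_sum frag_extend_cmul lookup_sum o_def)
qed

lemma dpsi_linear_ext_single:
  assumes "n \<noteq> 0" "p \<in> int_supp n" "\<And>q. q \<in> int_supp n \<Longrightarrow> q \<noteq> p \<Longrightarrow> w q = 0"
  shows "dpsi (linear_ext w) n = arith_coeff n p * w p"
  using assms finite_int_supp[OF assms(1)]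
  by (simp add: dpsi_linear_ext sum.remove)

lemma arith_coeff_pos:
  assumes "n > 0" "p \<in> int_supp n"
  shows "arith_coeff n p > 0"
proof -
  have p: "prime (int p)" "int p dvd n" using assms by (auto simp: int_supp_def)
  then have "multiplicity (int p) n > 0"
    using assms(1) by (simp add: prime_multiplicity_gt_zero_iff)
  then have "0 < n * int (multiplicity (int p) n)" using assms(1) by simp
  \<comment> \<open>The division by \<open>p\<close> is exact, so a positive numerator is at least
    \<open>p\<close> and the quotient cannot round down to 0.\<close>
  then have "int p \<le> n * int (multiplicity (int p) n)"
    using arith_d_coeff_dvd[OF assms(2)] by (rule zdvd_imp_le[rotated])
  then show ?thesis
    using prime_gt_0_int[OF p(1)] by (simp add: arith_coeff_def pos_imp_zdiv_pos_iff)
qed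

text \<open>If v is the multiplicity, 2^v \<le> p^v \<le> n bounds v by the logarithm, and dividing
  by p \<ge> 2 gains the factor 1/2. That factor later offsets a + b + c = 2c.\<close>

lemma arith_coeff_le:
  assumes "n > 0" "p \<in> int_supp n"
  shows "of_int (arith_coeff n p) \<le> of_int n * log 2 (of_int n) / 2"
proof -
  define v where "v = multiplicity (int p) n"
  have p: "p \<ge> 2" using assms by (auto simp: int_supp_def prime_ge_2_nat)
  have "int p ^ v \<le> n"
    using assms(1) by (intro zdvd_imp_le) (simp_all add: v_def multiplicity_dvd)
  moreover have "(2::int) ^ v \<le> int p ^ v" using p by (intro power_mono) auto
  ultimately have "(2::int) ^ v \<le> n" by linarith
  then have "(2::real) ^ v \<le> of_int n" by (metis of_int_le_iff of_int_numeral of_int_power)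
  then have v: "real v \<le> log 2 (of_int n)"
    using assms(1) by (simp add: le_log_iff powr_realpow)
  have "real_of_int (arith_coeff n p) \<le> of_int (n * int v) / real p"
    unfolding arith_coeff_def v_def[symmetric]
    using real_of_int_div4[of "n * int v" "int p"] by simp
  also have "\<dots> \<le> of_int (n * int v) / 2"
    using p assms(1) by (intro divide_left_mono) auto
  also have "\<dots> \<le> of_int n * log 2 (of_int n) / 2"
    using v assms(1) by simp
  finally show ?thesis .
qed

text \<open>The cube of side \<open>H\<close> has (H+1)^3 integer points, more than the number of
  values available to the form C z - A x - B y, so two points collide.\<close>

lemma siegel_three_unknowns:
  fixes A B C H :: int
  assumes "A > 0" "B \<ge> 0" "C \<ge> 0" "H \<ge> 0" "A + B + C < (H + 1)\<^sup>2"
  obtains x y z where "A * x + B * y = C * z" "(x, y, z) \<noteq> (0, 0, 0)"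
    "\<bar>x\<bar> \<le> H" "\<bar>y\<bar> \<le> H" "\<bar>z\<bar> \<le> H"
proof -
  let ?S = "{0..H} \<times> {0..H} \<times> {0..H}"
  \<comment> \<open>The extremes of the form on the cube: the minimum at x = y = H, z = 0, the
    maximum at x = y = 0, z = H.\<close>
  let ?T = "{- (H * (A + B))..H * C}"
  define g where "g = (\<lambda>(x, y, z). C * z - A * x - B * y)"
  have "g ` ?S \<subseteq> ?T"
  proof clarsimp
    fix x y z assume *: "0 \<le> x" "x \<le> H" "0 \<le> y" "y \<le> H" "0 \<le> z" "z \<le> H"
    have "A * x \<le> A * H" "B * y \<le> B * H" "C * z \<le> C * H" "0 \<le> A * x" "0 \<le> B * y" "0 \<le> C * z"
      using * assms by (auto intro: mult_left_mono)
    then show "- (H * (A + B)) \<le> g (x, y, z) \<and> g (x, y, z) \<le> H * C"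
      by (simp add: g_def algebra_simps)
  qed
  moreover have "card ?T < card ?S"
  proof -
    \<comment> \<open>The two sides differ by H + (A + B + C), which is positive.\<close>
    have "H * (A + B + C) + 1 < (H + 1) * (A + B + C + 1)"
      using assms by (simp add: algebra_simps)
    also have "\<dots> \<le> (H + 1) * (H + 1)\<^sup>2"
      using assms by (intro mult_left_mono) auto
    finally have less: "H * (A + B + C) + 1 < (H + 1) * (H + 1)\<^sup>2" .
    have "int (card ?T) = H * (A + B + C) + 1"
      using assms by (simp add: algebra_simps)
    moreover have "int (card ?S) = (H + 1) * (H + 1)\<^sup>2"
      using assms by (simp add: card_cartesian_product power2_eq_square)
    ultimately show ?thesis using less by linarith
  qed
  ultimately have "\<not> inj_on g ?S"
    by (meson card_inj_on_le finite_atLeastAtMost_int not_less)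
  then obtain x y z x' y' z' where *: "(x, y, z) \<in> ?S" "(x', y', z') \<in> ?S"
    "g (x, y, z) = g (x', y', z')" "(x, y, z) \<noteq> (x', y', z')"
    unfolding inj_on_def by (metis prod_cases3)
  show thesis
    \<comment> \<open>The difference of the colliding points is a nonzero zero of the form;
      coordinates in 0..H differ by at most \<open>H\<close>.\<close>
    by (rule that[of "x - x'" "y - y'" "z - z'"])
      (use * in \<open>auto simp: g_def algebra_simps\<close>)
qed

lemma exists_prime_int_supp:
  assumes "n > 1"
  obtains p where "p \<in> int_supp n"
proof -
  have "nat n \<noteq> 1" using assms by simp
  then obtain p where "prime p" "p dvd nat \<bar>n\<bar>"
    using assms prime_factor_nat[of "nat n"] by auto
  then show thesis using that[of p] by (simp add: int_supp_def)
qed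

text \<open>A bound valid for every triple; exceptions arise only when it is compared with the power
  of \<open>c\<close>.\<close>

lemma exists_small_tangent:
  fixes a b c :: int
  assumes abc: "a > 1" "b > 1" "c > 1" "Gcd {a, b, c} = 1" "a + b = c"
  obtains \<psi> where "\<psi> \<in> tangent_at a b"
    "tnorm \<psi> \<le> ereal (sqrt (of_int c * log 2 (of_int c)))"
    "\<not> (dpsi \<psi> a = 0 \<and> dpsi \<psi> b = 0 \<and> dpsi \<psi> c = 0)"
proof -
  obtain p q r where p: "p \<in> int_supp a" and q: "q \<in> int_supp b" and r: "r \<in> int_supp c"
    using abc exists_prime_int_supp by metis
  have disj: "int_supp a \<inter> int_supp b = {}" "int_supp a \<inter> int_supp c = {}"
    "int_supp b \<inter> int_supp c = {}"
  \<comment> \<open>Since a + b = c, a prime dividing two of the numbers divides the third, so the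
    joint gcd condition yields pairwise coprimality.\<close>
  proof -
    have "\<not> (prime s \<and> int s dvd a \<and> int s dvd b \<and> int s dvd c)" for s
    proof
      assume *: "prime s \<and> int s dvd a \<and> int s dvd b \<and> int s dvd c"
      then have "int s dvd Gcd {a, b, c}" by (intro Gcd_greatest) auto
      then have "int s dvd 1" using abc(4) by metis
      then show False using * by auto
    qed
    moreover have "int s dvd a \<Longrightarrow> int s dvd b \<Longrightarrow> int s dvd c"
      "int s dvd a \<Longrightarrow> int s dvd c \<Longrightarrow> int s dvd b"
      "int s dvd b \<Longrightarrow> int s dvd c \<Longrightarrow> int s dvd a" for s
      using abc(5) dvd_add_right_iff[of "int s" a b] dvd_add_left_iff[of "int s" b a] by auto
    ultimately show "int_supp a \<inter> int_supp b = {}" "int_supp a \<inter> int_supp c = {}"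
      "int_supp b \<inter> int_supp c = {}"
      unfolding int_supp_def by blast+
  qed
  then have ne: "p \<noteq> q" "p \<noteq> r" "q \<noteq> r" using p q r by auto
  define A B C where "A = arith_coeff a p" and "B = arith_coeff b q" and "C = arith_coeff c r"
  have pos: "A > 0" "B > 0" "C > 0"
    using abc p q r by (auto simp: A_def B_def C_def intro: arith_coeff_pos)
  \<comment> \<open>Rounding down keeps \<open>H\<close> below the square root, as the norm bound
    needs, while H + 1 exceeds it, as the pigeonhole count needs.\<close>
  define H where "H = \<lfloor>sqrt (of_int (A + B + C))\<rfloor>"
  have H0: "H \<ge> 0" using pos by (simp add: H_def)
  have "sqrt (of_int (A + B + C)) < of_int (H + 1)" by (simp add: H_def)
  then have "(sqrt (of_int (A + B + C)))\<^sup>2 < (of_int (H + 1))\<^sup>2"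
    using pos by (intro power_strict_mono) auto
  then have "real_of_int (A + B + C) < of_int ((H + 1)\<^sup>2)"
    using pos by simp
  then have "A + B + C < (H + 1)\<^sup>2" by (simp only: of_int_less_iff)
  then obtain x y z where xyz: "A * x + B * y = C * z" "(x, y, z) \<noteq> (0, 0, 0)"
    "\<bar>x\<bar> \<le> H" "\<bar>y\<bar> \<le> H" "\<bar>z\<bar> \<le> H"
    using siegel_three_unknowns pos H0 by (metis less_imp_le)
  define w where "w = (\<lambda>_::nat. 0::int)(p := x, q := y, r := z)"
  have w_le: "\<bar>w s\<bar> \<le> H" for s using xyz H0 by (simp add: w_def)
  have w: "w p = x" "w q = y" "w r = z" using ne by (auto simp: w_def)
  have w0: "w s = 0" if "s \<notin> {p, q, r}" for s using that by (simp add: w_def)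
  \<comment> \<open>By disjointness of the supports, neither \<open>q\<close> nor \<open>r\<close>
    divides \<open>a\<close>, so only the term at \<open>p\<close> survives; likewise for
    \<open>b\<close> and \<open>c\<close>.\<close>
  have da: "dpsi (linear_ext w) a = A * x"
    unfolding A_def w(1)[symmetric]
  proof (rule dpsi_linear_ext_single)
    show "w s = 0" if "s \<in> int_supp a" "s \<noteq> p" for s
      by (rule w0) (use that p q r disj in blast)
  qed (use abc(1) p in auto)
  have db: "dpsi (linear_ext w) b = B * y"
    unfolding B_def w(2)[symmetric]
  proof (rule dpsi_linear_ext_single)
    show "w s = 0" if "s \<in> int_supp b" "s \<noteq> q" for s
      by (rule w0) (use that p q r disj in blast)
  qed (use abc(2) q in auto)
  have dc: "dpsi (linear_ext w) c = C * z"
    unfolding C_def w(3)[symmetric]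
  proof (rule dpsi_linear_ext_single)
    show "w s = 0" if "s \<in> int_supp c" "s \<noteq> r" for s
      by (rule w0) (use that p q r disj in blast)
  qed (use abc(3) r in auto)
  have "tsupp (linear_ext w) \<subseteq> {p, q, r}"
    by (auto simp: tsupp_def linear_ext_frag_of w_def split: if_splits)
  also have "\<dots> \<subseteq> int_supp (a * b * (a + b))"
    using p q r abc(5) by (auto simp: int_supp_def)
  finally have tangent: "linear_ext w \<in> tangent_at a b"
    using da db dc xyz(1) abc(5) linear_ext_in_tangent[OF w_le] by (simp add: tangent_at_def)
  have log_mono: "log 2 (real_of_int a) \<le> log 2 (of_int c)" "log 2 (real_of_int b) \<le> log 2 (of_int c)"
    using abc by auto
  have "real_of_int A \<le> of_int a * log 2 (of_int c) / 2"
    using arith_coeff_le[OF _ p] log_mono(1) abc unfolding A_def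
    by (smt (verit) divide_right_mono mult_left_mono of_int_0_le_iff)
  moreover have "real_of_int B \<le> of_int b * log 2 (of_int c) / 2"
    using arith_coeff_le[OF _ q] log_mono(2) abc unfolding B_def
    by (smt (verit) divide_right_mono mult_left_mono of_int_0_le_iff)
  moreover have "real_of_int C \<le> of_int c * log 2 (of_int c) / 2"
    using arith_coeff_le[OF _ r] abc unfolding C_def by simp
  \<comment> \<open>The three halves add up to (a + b + c)/2 = c times the logarithm.\<close>
  ultimately have "real_of_int (A + B + C) \<le> of_int c * log 2 (of_int c)"
    using abc(5) by (auto simp: field_simps)
  then have "of_int H \<le> sqrt (of_int c * log 2 (of_int c))"
    unfolding H_def by (meson of_int_floor_le order_trans real_sqrt_le_mono)
  then have "tnorm (linear_ext w) \<le> ereal (sqrt (of_int c * log 2 (of_int c)))"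
    using tnorm_linear_ext_le[OF w_le] by (meson ereal_less_eq(3) order_trans)
  then show thesis
    using that tangent da db dc xyz(2) pos by auto
qed

theorem theorem2p8:
  fixes \<epsilon> :: real
  assumes "\<epsilon> > 0"
  shows "finite {(a::int, b::int, c::int).
           a > 1 \<and> b > 1 \<and> c > 1 \<and> Gcd {a, b, c} = 1 \<and> a + b = c \<and>
           \<not> (\<exists>\<psi> \<in> tangent_at a b.
                 tnorm \<psi> < ereal (of_int c powr (1 / 2 + \<epsilon>)) \<and>
                 \<not> (dpsi \<psi> a = 0 \<and> dpsi \<psi> b = 0 \<and> dpsi \<psi> c = 0))}"
    (is "finite ?E")
proof -
  \<comment> \<open>After division by x^(1/2), this says that the square root of a logarithm is
    eventually below x^\<epsilon>.\<close>
  have "eventually (\<lambda>x::real. sqrt (x * log 2 x) < x powr (1 / 2 + \<epsilon>)) at_top"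
    using assms by real_asymp
  then obtain N where N: "\<And>x. x \<ge> N \<Longrightarrow> sqrt (x * log 2 x) < x powr (1 / 2 + \<epsilon>)"
    unfolding eventually_at_top_linorder by blast
  have bound: "c \<le> \<lceil>N\<rceil>"
    if abc: "a > 1" "b > 1" "c > 1" "Gcd {a, b, c} = 1" "a + b = c"
      and no: "\<not> (\<exists>\<psi> \<in> tangent_at a b. tnorm \<psi> < ereal (of_int c powr (1 / 2 + \<epsilon>)) \<and>
                 \<not> (dpsi \<psi> a = 0 \<and> dpsi \<psi> b = 0 \<and> dpsi \<psi> c = 0))"
    for a b c :: int
  proof -
    obtain \<psi> where "\<psi> \<in> tangent_at a b"
      "tnorm \<psi> \<le> ereal (sqrt (of_int c * log 2 (of_int c)))"
      "\<not> (dpsi \<psi> a = 0 \<and> dpsi \<psi> b = 0 \<and> dpsi \<psi> c = 0)"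
      using exists_small_tangent[OF abc] .
    then have "\<not> sqrt (of_int c * log 2 (of_int c)) < of_int c powr (1 / 2 + \<epsilon>)"
      using no by (meson le_less_trans less_ereal.simps(1))
    then show ?thesis
      using N[of "of_int c"] by linarith
  qed
  \<comment> \<open>As \<open>a\<close> and \<open>b\<close> are positive with sum \<open>c\<close>,
    bounding \<open>c\<close> confines the whole triple to a finite cube.\<close>
  have "?E \<subseteq> {0..\<lceil>N\<rceil>} \<times> {0..\<lceil>N\<rceil>} \<times> {0..\<lceil>N\<rceil>}"
  proof
    fix t assume "t \<in> ?E"
    moreover obtain a b c where t: "t = (a, b, c)" by (cases t)
    ultimately have "a > 1 \<and> b > 1 \<and> a + b = c \<and> c \<le> \<lceil>N\<rceil>"
      using bound[of a b c] by (simp only: mem_Collect_eq prod.case) blast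
    then show "t \<in> {0..\<lceil>N\<rceil>} \<times> {0..\<lceil>N\<rceil>} \<times> {0..\<lceil>N\<rceil>}"
      using t by auto
  qed
  then show ?thesis by (rule finite_subset) simp
qed

end
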